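(* Let $\epsilon\in(0,1)$ and let $K$ be a positive integer with $K \geq 2.5\, \frac{\log(1/\epsilon)}{\epsilon}$. Then $$\liminf_{n \to +\infty} \ \mathbb{P}\left(1 \in H_{\psi}(\mathrm{UA}(n)^{\circ})\right) \geq 1 - \frac{4 \epsilon}{1-\epsilon}.$$
   Context: Write $[n]=\{1,\dots,n\}$. The uniform attachment tree $\mathrm{UA}(n)$, $n\ge 2$, is the random labeled tree on vertex set $[n]$ defined inductively: $\mathrm{UA}(2)$ is the unique tree on two vertices, and $\mathrm{UA}(n+1)$ is obtained from $\mathrm{UA}(n)$ by adding the vertex $n+1$ and an edge $\{i,n+1\}$ with $i\in[n]$ chosen uniformly at random. $T^\circ$ denotes the unlabeled copy (isomorphism class) of a labeled tree $T$; vertices of $T^\circ$ are denoted using the labels of $T$. For a tree $T$ with vertex set $V(T)$ and $u\in V(T)$, let $(T,u)$ be the tree rooted at $u$, and $(T,u)_{v\downarrow}$ the subtree consisting of $v$ and all its descendants when $T$ is rooted at $u$; $|\cdot|$ is the number of vertices. Define $$\psi_T(u)=\max_{v\in V(T)\setminus\{u\}} |(T,u)_{v\downarrow}| .$$ (This does not depend on the labeling of the tree.) $H_\psi$ is the mapping which, given a tree $T$ with at least $K$ vertices, returns the set of $K$ vertices with smallest $\psi_T$ values, ties being broken arbitrarily. *)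

theory Defs
  imports "HOL-Probability.Probability"
begin

type_synonym 'a graph = "'a set \<times> 'a set set"

abbreviation verts :: "'a graph \<Rightarrow> 'a set" where
  "verts \<equiv> fst"

abbreviation edges :: "'a graph \<Rightarrow> 'a set set" where
  "edges \<equiv> snd"

definition is_path :: "'a graph \<Rightarrow> 'a \<Rightarrow> 'a list \<Rightarrow> 'a \<Rightarrow> bool" where
  "is_path T u p v \<longleftrightarrow>
     p \<noteq> [] \<and> hd p = u \<and> last p = v \<and> distinct p \<and> set p \<subseteq> verts T \<and>
     successively (\<lambda>x y. {x, y} \<in> edges T) p"

definition is_tree :: "'a graph \<Rightarrow> bool" where
  "is_tree T \<longleftrightarrow>
     finite (verts T) \<and> verts T \<noteq> {} \<and>
     edges T \<subseteq> {{x, y} | x y. x \<in> verts T \<and> y \<in> verts T \<and> x \<noteq> y} \<and>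
     (\<forall>u\<in>verts T. \<forall>v\<in>verts T. \<exists>!p. is_path T u p v)"

definition graph_iso :: "('a \<Rightarrow> 'b) \<Rightarrow> 'a graph \<Rightarrow> 'b graph \<Rightarrow> bool" where
  "graph_iso f T T' \<longleftrightarrow>
     bij_betw f (verts T) (verts T') \<and> edges T' = (\<lambda>e. f ` e) ` edges T"

definition unlabeled :: "nat graph \<Rightarrow> nat graph set" where
  "unlabeled T = {T'. \<exists>f. graph_iso f T T'}"

definition unlabeled_trees :: "nat graph set set" where
  "unlabeled_trees = unlabeled ` {T. is_tree T}"

text \<open>An isomorphism class has no vertices of its own. A naming provides them: \<open>rep C\<close> is a
  concrete tree whose vertices serve as the vertices of the unlabeled tree \<open>C\<close>, and
  \<open>name T v\<close> is the vertex of the unlabeled copy of \<open>T\<close> that is denoted by the label \<open>v\<close>.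
  When \<open>T\<close> has nontrivial automorphisms \<open>name T\<close> is not determined; any choice is allowed.\<close>

definition vertex_naming ::
    "(nat graph set \<Rightarrow> nat graph) \<Rightarrow> (nat graph \<Rightarrow> nat \<Rightarrow> nat) \<Rightarrow> bool" where
  "vertex_naming rep name \<longleftrightarrow>
     (\<forall>T. is_tree T \<longrightarrow> graph_iso (name T) T (rep (unlabeled T)))"

text \<open>The vertex set of \<open>(T,u)\<^bsub>v\<down>\<^esub>\<close>: in \<open>T\<close> rooted at \<open>u\<close>, a vertex \<open>w\<close> is \<open>v\<close> or a descendant
  of \<open>v\<close> iff \<open>v\<close> lies on the path from \<open>u\<close> to \<open>w\<close>.\<close>

definition subtree_verts :: "'a graph \<Rightarrow> 'a \<Rightarrow> 'a \<Rightarrow> 'a set" where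
  "subtree_verts T u v = {w \<in> verts T. \<exists>p. is_path T u p w \<and> v \<in> set p}"

definition psi :: "'a graph \<Rightarrow> 'a \<Rightarrow> nat" where
  "psi T u = Max ((\<lambda>v. card (subtree_verts T u v)) ` (verts T - {u}))"

definition smallest_psi :: "nat \<Rightarrow> 'a graph \<Rightarrow> 'a set \<Rightarrow> bool" where
  "smallest_psi K T S \<longleftrightarrow>
     S \<subseteq> verts T \<and> card S = K \<and> (\<forall>x\<in>S. \<forall>y\<in>verts T - S. psi T x \<le> psi T y)"

text \<open>The possible mappings \<open>H\<^sub>\<psi>\<close> on unlabeled trees, one for each way of breaking ties.\<close>

definition is_H_psi ::
    "nat \<Rightarrow> (nat graph set \<Rightarrow> nat graph) \<Rightarrow> (nat graph set \<Rightarrow> nat set) \<Rightarrow> bool" where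
  "is_H_psi K rep H \<longleftrightarrow>
     (\<forall>C\<in>unlabeled_trees. K \<le> card (verts (rep C)) \<longrightarrow> smallest_psi K (rep C) (H C))"

text \<open>Only the values for \<open>n \<ge> 2\<close> are meaningful; \<open>UA 0\<close> and \<open>UA 1\<close> are set to \<open>UA 2\<close>.\<close>

primrec UA :: "nat \<Rightarrow> nat graph pmf" where
  "UA 0 = return_pmf ({1, 2}, {{1, 2}})"
| "UA (Suc n) =
     (if n < 2 then return_pmf ({1, 2}, {{1, 2}})
      else bind_pmf (UA n) (\<lambda>T.
           map_pmf (\<lambda>i. (insert (Suc n) (verts T), insert {i, Suc n} (edges T)))
             (pmf_of_set {1..n})))"

end

theory Submission imports Defs begin

text \<open>
  Why the root is found. For a vertex \<open>i\<close> later than \<open>K\<close>, the first \<open>K\<close> vertices stay connected when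
  \<open>i\<close> is removed. Split the tree into \<open>K\<close> branches by deleting the edges among the first \<open>K\<close> vertices:
  all branches except the one of \<open>i\<close> then hang together as seen from \<open>i\<close>, so \<open>psi\<close> of \<open>i\<close> is at least
  \<open>n\<close> minus the size of one branch (\<open>card_branch_complement_le_psi\<close>). If every branch has fewer than
  \<open>\<epsilon> * n\<close> vertices, all vertices after \<open>K\<close> score above \<open>(1 - \<epsilon>) * n\<close>. The score of the root, on the
  other hand, is at most the larger of the two branches obtained by cutting the very first edge
  (\<open>psi_root_le\<close>). If that is below \<open>(1 - \<epsilon>) * n\<close>, no vertex after \<open>K\<close> ties or beats the root, and so the
  root is among the \<open>K\<close> vertices returned (\<open>smallest_psi_omits\<close>). Since \<open>psi\<close> is invariant under
  isomorphism (\<open>psi_iso\<close>), all of this may be done in the labeled tree.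

  The branch sizes form a Polya urn: a new vertex joins a branch with probability proportional to
  its size. Hence the tail of one branch size is a quotient of binomial coefficients
  (\<open>branch_tail_eq\<close>), at most about \<open>(1 - x) ^ (K - 1)\<close> at the threshold \<open>x * n\<close> (\<open>branch_tail_le\<close>).
  For two branches and \<open>x = 1 - \<epsilon>\<close> the union bound gives about \<open>2 * \<epsilon>\<close>; for \<open>K\<close> branches and \<open>x = \<epsilon>\<close> it
  gives about \<open>K * (1 - \<epsilon>) ^ (K - 1)\<close>, and the assumption on \<open>K\<close> makes this at most \<open>2 * \<epsilon> / (1 - \<epsilon>)\<close>
  for \<open>\<epsilon> < 1 / 5\<close> (\<open>exceptional_branch_bound\<close>). The two errors then add up to at most
  \<open>4 * \<epsilon> / (1 - \<epsilon>)\<close>, and for \<open>\<epsilon> \<ge> 1 / 5\<close> this quantity is at least 1, so nothing is claimed.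
\<close>

section \<open>Paths and leaf attachment\<close>

lemma is_path_rev: "is_path T u p v \<Longrightarrow> is_path T v (rev p) u"
  by (auto simp: is_path_def hd_rev last_rev insert_commute)

lemma is_path_refl: "u \<in> verts T \<Longrightarrow> is_path T u [u] u"
  by (simp add: is_path_def)

text \<open>The growth step of the process. Keeping it separate from the tree lets the tree property be
  carried along one new leaf at a time.\<close>

definition attach :: "'a graph \<Rightarrow> 'a \<Rightarrow> 'a \<Rightarrow> 'a graph" where
  "attach T i x = (insert x (verts T), insert {i, x} (edges T))"

context
  fixes T :: "'a graph" and i x :: 'a
  assumes E: "edges T \<subseteq> {{x, y} | x y. x \<in> verts T \<and> y \<in> verts T \<and> x \<noteq> y}"
    and i: "i \<in> verts T" and x: "x \<notin> verts T"
begin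

lemma attach_neighbour: "{a, x} \<in> edges (attach T i x) \<Longrightarrow> a = i"
  using E i x by (auto simp: attach_def doubleton_eq_iff)

lemma is_path_attach_avoiding:
  assumes "x \<notin> set p"
  shows "is_path (attach T i x) u p v \<longleftrightarrow> is_path T u p v"
proof -
  have "successively (\<lambda>a b. {a, b} \<in> edges (attach T i x)) p \<longleftrightarrow>
        successively (\<lambda>a b. {a, b} \<in> edges T) p"
    using assms by (intro successively_cong) (auto simp: attach_def doubleton_eq_iff)
  then show ?thesis
    using assms by (auto simp: is_path_def attach_def)
qed

text \<open>The new vertex \<open>x\<close> has \<open>i\<close> as its only neighbour, so a path with \<open>x\<close> in its interior would visit
  \<open>i\<close> both before and after \<open>x\<close>. Hence old vertices are joined by exactly the same paths as before.\<close>

lemma is_path_attach_old: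
  assumes "u \<noteq> x" "v \<noteq> x"
  shows "is_path (attach T i x) u p v \<longleftrightarrow> is_path T u p v"
proof (cases "x \<in> set p")
  case True
  have "\<not> is_path (attach T i x) u p v"
  proof
    assume p: "is_path (attach T i x) u p v"
    obtain a b where ab: "p = a @ x # b" using True by (auto simp: in_set_conv_decomp)
    have ne: "a \<noteq> []" "b \<noteq> []" using p ab assms by (auto simp: is_path_def)
    have "{last a, x} \<in> edges (attach T i x)" "{x, hd b} \<in> edges (attach T i x)"
      using p ne unfolding ab by (auto simp: is_path_def successively_append_iff successively_Cons)
    then have "last a = i" "hd b = i"
      using attach_neighbour[of "last a"] attach_neighbour[of "hd b"] by (auto simp: insert_commute)
    then have "i \<in> set a \<inter> set b" using ne by (metis IntI hd_in_set last_in_set)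
    with p ab show False by (auto simp: is_path_def)
  qed
  moreover have "\<not> is_path T u p v" using True x by (auto simp: is_path_def)
  ultimately show ?thesis by simp
qed (rule is_path_attach_avoiding)

text \<open>A path into the new leaf has to arrive from its only neighbour \<open>i\<close>. Together with the previous
  lemma this describes all paths of the enlarged tree, so uniqueness of paths is inherited.\<close>

lemma is_path_attach_new:
  assumes "u \<noteq> x"
  shows "is_path (attach T i x) u p x \<longleftrightarrow> (\<exists>q. p = q @ [x] \<and> is_path T u q i)"
proof
  assume p: "is_path (attach T i x) u p x"
  define q where "q = butlast p"
  have pq: "p = q @ [x]" using p by (auto simp: is_path_def q_def)
  have ne: "q \<noteq> []" using p pq assms by (auto simp: is_path_def)
  have "{last q, x} \<in> edges (attach T i x)"
    using p ne unfolding pq by (auto simp: is_path_def successively_append_iff)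
  then have "last q = i" by (rule attach_neighbour)
  moreover have xq: "x \<notin> set q" using p pq by (auto simp: is_path_def)
  ultimately have "is_path (attach T i x) u q i"
    using p ne unfolding pq by (auto simp: is_path_def successively_append_iff)
  with xq pq show "\<exists>q. p = q @ [x] \<and> is_path T u q i" by (auto simp: is_path_attach_avoiding)
next
  assume "\<exists>q. p = q @ [x] \<and> is_path T u q i"
  then obtain q where pq: "p = q @ [x]" and q: "is_path T u q i" by auto
  have "x \<notin> set q" using q x by (auto simp: is_path_def)
  then have "is_path (attach T i x) u q i" using q by (simp add: is_path_attach_avoiding)
  with \<open>x \<notin> set q\<close> show "is_path (attach T i x) u p x"
    unfolding pq by (auto simp: is_path_def successively_append_iff attach_def)
qed

end

lemma is_tree_attach:
  assumes T: "is_tree T" and i: "i \<in> verts T" and x: "x \<notin> verts T"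
  shows "is_tree (attach T i x)"
proof -
  have E: "edges T \<subseteq> {{x, y} | x y. x \<in> verts T \<and> y \<in> verts T \<and> x \<noteq> y}"
    and uniq: "\<And>u v. u \<in> verts T \<Longrightarrow> v \<in> verts T \<Longrightarrow> \<exists>!p. is_path T u p v"
    using T by (auto simp: is_tree_def)
  note old = is_path_attach_old[OF E i x] and new = is_path_attach_new[OF E i x]
  have to_leaf: "\<exists>!p. is_path (attach T i x) u p x" if u: "u \<in> verts T" for u
  proof -
    have "u \<noteq> x" using u x by auto
    then show ?thesis using uniq[OF u i] by (auto simp: new)
  qed
  have from_leaf: "\<exists>!p. is_path (attach T i x) x p u" if "u \<in> verts T" for u
    using to_leaf[OF that] by (metis is_path_rev rev_rev_ident)
  have leaf: "\<exists>!p. is_path (attach T i x) x p x"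
  proof
    show "is_path (attach T i x) x [x] x" by (rule is_path_refl) (simp add: attach_def)
  next
    fix p assume p: "is_path (attach T i x) x p x"
    then obtain r where r: "p = x # r" by (cases p) (auto simp: is_path_def)
    then have "r = []" using p by (auto simp: is_path_def split: if_splits)
    with r show "p = [x]" by simp
  qed
  have "\<exists>!p. is_path (attach T i x) u p v"
    if "u \<in> verts T" "v \<in> verts T" for u v
  proof -
    have "u \<noteq> x" "v \<noteq> x" using that x by auto
    then show ?thesis using uniq[OF that] by (simp add: old)
  qed
  then have "\<forall>u\<in>verts (attach T i x). \<forall>v\<in>verts (attach T i x). \<exists>!p. is_path (attach T i x) u p v"
    using to_leaf from_leaf leaf by (simp add: attach_def)
  moreover have "finite (verts (attach T i x))" "verts (attach T i x) \<noteq> {}"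
    using T by (auto simp: is_tree_def attach_def)
  moreover have "edges (attach T i x) \<subseteq>
    {{a, b} | a b. a \<in> verts (attach T i x) \<and> b \<in> verts (attach T i x) \<and> a \<noteq> b}"
    (is "_ \<subseteq> ?P")
  proof -
    have "{i, x} \<in> ?P" using i x by (auto simp: attach_def)
    moreover have "edges T \<subseteq> ?P" using E by (simp add: attach_def) blast
    ultimately show ?thesis by (simp add: attach_def)
  qed
  ultimately show ?thesis unfolding is_tree_def by blast
qed

section \<open>Isomorphism invariance\<close>

lemma graph_iso_inv_into:
  assumes f: "graph_iso f T T'" and E: "\<Union> (edges T) \<subseteq> verts T"
  shows "graph_iso (inv_into (verts T) f) T' T"
proof -
  have b: "bij_betw f (verts T) (verts T')" and e: "edges T' = (\<lambda>e. f ` e) ` edges T"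
    using f by (auto simp: graph_iso_def)
  have "inj_on f (verts T)" using b by (simp add: bij_betw_def)
  then have cancel: "inv_into (verts T) f ` f ` e = e" if "e \<in> edges T" for e
    by (rule inv_into_image_cancel) (use that E in blast)
  have "(\<lambda>e. inv_into (verts T) f ` e) ` edges T' = (\<lambda>e. inv_into (verts T) f ` f ` e) ` edges T"
    unfolding e by (rule image_image)
  also have "\<dots> = (\<lambda>e. e) ` edges T"
    using cancel by (rule image_cong[OF refl])
  finally have "(\<lambda>e. inv_into (verts T) f ` e) ` edges T' = edges T" by simp
  then show ?thesis using b by (simp add: graph_iso_def bij_betw_inv_into)
qed

lemma is_path_iso:
  assumes f: "graph_iso f T T'" and p: "is_path T u p v"
  shows "is_path T' (f u) (map f p) (f v)"
proof -
  have "inj_on f (verts T)" "set p \<subseteq> verts T"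
    using f p by (simp_all add: graph_iso_def is_path_def bij_betw_def)
  then have inj: "inj_on f (set p)" by (rule inj_on_subset)
  have "successively (\<lambda>x y. {f x, f y} \<in> edges T') p"
  proof (rule successively_mono)
    show "successively (\<lambda>x y. {x, y} \<in> edges T) p" using p by (simp add: is_path_def)
    fix x y assume "{x, y} \<in> edges T"
    then have "f ` {x, y} \<in> edges T'" using f unfolding graph_iso_def by blast
    then show "{f x, f y} \<in> edges T'" by simp
  qed
  moreover have "set p \<subseteq> verts T" "f ` verts T = verts T'"
    using f p by (auto simp: graph_iso_def is_path_def bij_betw_def)
  then have "f ` set p \<subseteq> verts T'" by blast
  ultimately show ?thesis
    using p inj by (auto simp: is_path_def hd_map last_map distinct_map successively_map)
qed

text \<open>Applied to an isomorphism and to its inverse, this inclusion compares the cardinalities of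
  corresponding subtrees in both directions.\<close>

lemma image_subtree_verts_iso:
  assumes f: "graph_iso f T T'"
  shows "f ` subtree_verts T u v \<subseteq> subtree_verts T' (f u) (f v)"
proof
  fix y assume "y \<in> f ` subtree_verts T u v"
  then obtain w p where w: "y = f w" "w \<in> verts T" "is_path T u p w" "v \<in> set p"
    by (auto simp: subtree_verts_def)
  have "is_path T' (f u) (map f p) (f w)" using w(3) by (rule is_path_iso[OF f])
  moreover have "f w \<in> verts T'" using f w(2) by (auto simp: graph_iso_def bij_betw_def)
  moreover have "f v \<in> set (map f p)" using w(4) by simp
  ultimately show "y \<in> subtree_verts T' (f u) (f v)"
    unfolding subtree_verts_def w(1) by blast
qed

text \<open>This is what makes statements about the unlabeled copy accessible: scores may be computed in
  the labeled tree, whichever isomorphism the naming has chosen.\<close>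

lemma psi_iso:
  assumes f: "graph_iso f T T'" and T: "is_tree T" and u: "u \<in> verts T"
  shows "psi T' (f u) = psi T u"
proof -
  define g where "g = inv_into (verts T) f"
  have b: "bij_betw f (verts T) (verts T')" using f by (simp add: graph_iso_def)
  then have inj: "inj_on f (verts T)" and im: "f ` verts T = verts T'"
    by (auto simp: bij_betw_def)
  have "\<Union> (edges T) \<subseteq> verts T" using T by (fastforce simp: is_tree_def)
  then have g: "graph_iso g T' T" using graph_iso_inv_into[OF f] by (simp add: g_def)
  have gf: "g (f w) = w" if "w \<in> verts T" for w using that inj by (simp add: g_def)
  have "finite (verts T)" using T by (simp add: is_tree_def)
  then have fin: "finite (subtree_verts T u v)" "finite (subtree_verts T' (f u) w)" for v w
    by (simp_all add: subtree_verts_def flip: im)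
  have card: "card (subtree_verts T' (f u) (f v)) = card (subtree_verts T u v)"
    if v: "v \<in> verts T" for v
  proof (rule antisym)
    have "g ` subtree_verts T' (f u) (f v) \<subseteq> subtree_verts T u v"
      using image_subtree_verts_iso[OF g, of "f u" "f v"] u v by (simp add: gf)
    moreover have "inj_on g (subtree_verts T' (f u) (f v))"
    proof (rule inj_on_subset)
      show "inj_on g (verts T')" using g by (simp add: graph_iso_def bij_betw_def)
    qed (auto simp: subtree_verts_def)
    ultimately show "card (subtree_verts T' (f u) (f v)) \<le> card (subtree_verts T u v)"
      using fin by (metis card_image card_mono)
  next
    have "inj_on f (subtree_verts T u v)"
      using inj by (rule inj_on_subset) (auto simp: subtree_verts_def)
    then show "card (subtree_verts T u v) \<le> card (subtree_verts T' (f u) (f v))"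
      using fin image_subtree_verts_iso[OF f] by (metis card_image card_mono)
  qed
  have "verts T' - {f u} = f ` (verts T - {u})"
    using im inj u by (auto simp: inj_on_def)
  then have "(\<lambda>v. card (subtree_verts T' (f u) v)) ` (verts T' - {f u}) =
      (\<lambda>v. card (subtree_verts T u v)) ` (verts T - {u})"
    by (simp add: image_image card)
  then show ?thesis by (simp add: psi_def)
qed

text \<open>If the root is not returned, then \<open>K\<close> other vertices are, and they cannot all lie among the
  \<open>K - 1\<close> remaining vertices of \<open>{1..K}\<close>. So some later vertex beats or ties the root, and this
  holds for every way of breaking ties.\<close>

lemma smallest_psi_omits:
  assumes naming: "vertex_naming rep name" and H: "is_H_psi K rep H"
    and T: "is_tree T" and V: "verts T = {1..n}" and K: "0 < K" "K \<le> n"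
    and omit: "name T 1 \<notin> H (unlabeled T)"
  shows "\<exists>i\<in>{K<..n}. psi T i \<le> psi T 1"
proof -
  define R where "R = rep (unlabeled T)"
  define g where "g = name T"
  define S where "S = H (unlabeled T)"
  have g: "graph_iso g T R" using naming T unfolding vertex_naming_def R_def g_def by blast
  then have b: "bij_betw g {1..n} (verts R)" by (simp add: graph_iso_def V)
  then have "card (verts R) = n" by (metis bij_betw_same_card card_atLeastAtMost diff_Suc_1)
  moreover have "unlabeled T \<in> unlabeled_trees" using T by (auto simp: unlabeled_trees_def)
  ultimately have "smallest_psi K R S" using H K(2) by (simp add: is_H_psi_def R_def S_def)
  then have S: "S \<subseteq> verts R" "card S = K" "\<forall>x\<in>S. \<forall>y\<in>verts R - S. psi R x \<le> psi R y"
    by (simp_all add: smallest_psi_def)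
  define S' where "S' = {w \<in> {1..n}. g w \<in> S}"
  have "S \<subseteq> g ` {1..n}" using S(1) b by (simp add: bij_betw_def)
  then have "g ` S' = S" unfolding S'_def by blast
  moreover have "inj_on g S'"
  proof (rule inj_on_subset)
    show "inj_on g {1..n}" using b by (simp add: bij_betw_def)
  qed (auto simp: S'_def)
  ultimately have card: "card S' = K" using S(2) card_image by metis
  have one: "1 \<notin> S'" using omit by (simp add: S'_def g_def S_def)
  \<comment> \<open>By counting, \<open>S'\<close> must contain a vertex after \<open>K\<close>.\<close>
  have "\<not> S' \<subseteq> {2..K}"
    using card card_mono[of "{2..K}" S'] K by auto
  then obtain i where i: "i \<in> S'" "i \<notin> {2..K}" by blast
  have "i \<noteq> 1" "i \<in> {1..n}" using i one by (auto simp: S'_def)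
  then have iK: "i \<in> {K<..n}" using i by auto
  have "g 1 \<in> verts R - S"
    using b omit K by (auto simp: bij_betw_def g_def S_def)
  then have "psi R (g i) \<le> psi R (g 1)" using S(3) i by (auto simp: S'_def)
  then have "psi T i \<le> psi T 1"
    using psi_iso[OF g T] V iK K by auto
  then show ?thesis using iK by blast
qed

section \<open>Recursive trees and their branches\<close>

lemma is_tree_path_exists:
  assumes "is_tree T" "u \<in> verts T" "v \<in> verts T"
  shows "\<exists>p. is_path T u p v"
proof -
  have "\<exists>!p. is_path T u p v" using assms unfolding is_tree_def by simp
  then show ?thesis by (rule ex1_implies_ex)
qed

text \<open>A recursive tree on \<open>{1..n}\<close> is encoded by the function \<open>f\<close> that sends every vertex \<open>j \<ge> 2\<close> to the
  older vertex to which it was attached.\<close>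

definition parent_map :: "nat \<Rightarrow> (nat \<Rightarrow> nat) \<Rightarrow> bool" where
  "parent_map n f \<longleftrightarrow> (\<forall>j\<in>{2..n}. f j \<in> {1..<j})"

definition recursive_tree :: "nat \<Rightarrow> (nat \<Rightarrow> nat) \<Rightarrow> nat graph" where
  "recursive_tree n f = ({1..n}, (\<lambda>j. {f j, j}) ` {2..n})"

lemma recursive_tree_Suc:
  assumes "1 \<le> n"
  shows "recursive_tree (Suc n) (f(Suc n := i)) = attach (recursive_tree n f) i (Suc n)"
proof -
  have "{1..Suc n} = insert (Suc n) {1..n}" "{2..Suc n} = insert (Suc n) {2..n}"
    using assms by auto
  moreover have "(\<lambda>j. {(f(Suc n := i)) j, j}) ` {2..n} = (\<lambda>j. {f j, j}) ` {2..n}"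
    by (intro image_cong) auto
  ultimately show ?thesis by (simp add: recursive_tree_def attach_def)
qed

lemma is_tree_recursive_tree:
  assumes "1 \<le> n" "parent_map n f"
  shows "is_tree (recursive_tree n f)"
  using assms
proof (induction n rule: dec_induct)
  case base
  have "\<exists>!p. is_path ({1::nat}, {}) 1 p 1"
  proof
    fix p assume p: "is_path ({1::nat}, {}) 1 p 1"
    then obtain r where r: "p = 1 # r" by (cases p) (auto simp: is_path_def)
    then have "r = []" using p by (cases r) (auto simp: is_path_def)
    with r show "p = [1]" by simp
  qed (rule is_path_refl, simp)
  then show ?case by (simp add: recursive_tree_def is_tree_def)
next
  case (step n)
  have "f (Suc n) \<in> {1..<Suc n}"
    using step.prems step.hyps(1) unfolding parent_map_def by (elim bspec) simp
  moreover have "parent_map n f" using step.prems by (simp add: parent_map_def)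
  ultimately have "is_tree (recursive_tree n f)" "f (Suc n) \<in> {1..n}"
    using step.IH by auto
  then have "is_tree (attach (recursive_tree n f) (f (Suc n)) (Suc n))"
    by (intro is_tree_attach) (auto simp: recursive_tree_def)
  then show ?case
    using recursive_tree_Suc[OF step(1), of f "f (Suc n)"] by simp
qed

text \<open>\<open>branch K f w\<close> follows parents from \<open>w\<close> until it meets a vertex of \<open>{1..K}\<close>. The level sets of
  \<open>branch K f\<close> are the components of the forest left after deleting all edges inside \<open>{1..K}\<close>, each
  one rooted at its vertex in \<open>{1..K}\<close>. The guard \<open>f w < w\<close> makes the recursion
  terminate for every \<open>f\<close>; for a parent map it holds at every vertex above \<open>K \<ge> 1\<close>.\<close>

function branch :: "nat \<Rightarrow> (nat \<Rightarrow> nat) \<Rightarrow> nat \<Rightarrow> nat" where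
  "branch K f w = (if w \<le> K \<or> \<not> f w < w then w else branch K f (f w))"
  by auto
termination by (relation "Wellfounded.measure (\<lambda>(K, f, w). w)") auto

declare branch.simps [simp del]

lemma branch_root: "w \<le> K \<Longrightarrow> branch K f w = w"
  by (simp add: branch.simps)

lemma branch_in:
  assumes "parent_map n f" "1 \<le> K" "w \<in> {1..n}"
  shows "branch K f w \<in> {1..K}"
  using assms(3)
proof (induction w rule: less_induct)
  case (less w)
  show ?case
  proof (cases "w \<le> K")
    case False
    then have "w \<in> {2..n}" using less(2) assms(2) by auto
    then have "f w \<in> {1..<w}" using assms(1) by (auto simp: parent_map_def)
    then show ?thesis using less False by (subst branch.simps) auto
  qed (use less in \<open>auto simp: branch_root\<close>)
qed

text \<open>Leaving a branch is possible only through its root: an edge from \<open>j\<close> to its parent with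
  \<open>j > K\<close> stays inside one branch by the recursion.\<close>

lemma branch_edge:
  assumes "parent_map n f" "{x, y} \<in> edges (recursive_tree n f)" "branch K f x \<noteq> branch K f y"
  shows "x \<le> K" "y \<le> K"
proof -
  obtain j where j: "j \<in> {2..n}" "{x, y} = {f j, j}"
    using assms(2) by (auto simp: recursive_tree_def)
  have less: "f j < j" using assms(1) j(1) by (auto simp: parent_map_def)
  have "j \<le> K"
  proof (rule ccontr)
    assume "\<not> j \<le> K"
    then have "branch K f j = branch K f (f j)" using less by (subst branch.simps) simp
    with j(2) assms(3) show False by (auto simp: doubleton_eq_iff)
  qed
  with less j(2) show "x \<le> K" "y \<le> K" by (auto simp: doubleton_eq_iff)
qed

lemma successively_crossing:
  assumes "successively P p" "p \<noteq> []" "c (hd p) \<noteq> c (last p)"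
  shows "\<exists>x\<in>set p. \<exists>y\<in>set p. P x y \<and> c x = c (hd p) \<and> c x \<noteq> c y"
  using assms
proof (induction p)
  case (Cons a p)
  show ?case
  proof (cases "p = [] \<or> c (hd p) \<noteq> c a")
    case True
    with Cons.prems show ?thesis by (cases p) auto
  next
    case False
    then have "successively P p" "p \<noteq> []" "c (hd p) \<noteq> c (last p)"
      using Cons.prems by (auto simp: successively_Cons)
    then obtain x y where "x \<in> set p" "y \<in> set p" "P x y" "c x = c (hd p)" "c x \<noteq> c y"
      using Cons.IH by blast
    moreover have "c (hd (a # p)) = c (hd p)" using False by simp
    ultimately show ?thesis by (metis list.set_intros(2))
  qed
qed simp

definition branch_verts :: "nat \<Rightarrow> nat \<Rightarrow> (nat \<Rightarrow> nat) \<Rightarrow> nat \<Rightarrow> nat set" where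
  "branch_verts K n f k = {w \<in> {1..n}. branch K f w = k}"

text \<open>Let \<open>k\<close> be the root of the branch containing \<open>i\<close>. As \<open>i > K\<close>, the vertices \<open>i\<close> and \<open>k\<close> differ, and a
  path from \<open>i\<close> to any other branch has to leave through \<open>k\<close>. In the tree rooted at \<open>i\<close>, the subtree
  of \<open>k\<close> therefore contains every vertex outside that branch.\<close>

lemma card_branch_complement_le_psi:
  assumes f: "parent_map n f" and K: "1 \<le> K" and i: "i \<in> {K<..n}"
  shows "n - card (branch_verts K n f (branch K f i)) \<le> psi (recursive_tree n f) i"
proof -
  define T where "T = recursive_tree n f"
  define k where "k = branch K f i"
  have V: "verts T = {1..n}" by (simp add: T_def recursive_tree_def)
  have tree: "is_tree T" unfolding T_def using is_tree_recursive_tree[of n f] f K i by auto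
  have k: "k \<in> {1..K}" unfolding k_def using f K i by (intro branch_in) auto
  have "{1..n} - branch_verts K n f k \<subseteq> subtree_verts T i k"
  proof
    fix w assume w: "w \<in> {1..n} - branch_verts K n f k"
    then have ne: "branch K f w \<noteq> branch K f i" by (auto simp: branch_verts_def k_def)
    have "i \<in> verts T" "w \<in> verts T" using V i w K by simp_all
    then obtain p where p: "is_path T i p w" using is_tree_path_exists[OF tree] by blast
    have "\<exists>x\<in>set p. \<exists>y\<in>set p. {x, y} \<in> edges T \<and>
        branch K f x = branch K f (hd p) \<and> branch K f x \<noteq> branch K f y"
      by (rule successively_crossing) (use p ne in \<open>simp_all add: is_path_def\<close>)
    then obtain x y where xy: "x \<in> set p" "{x, y} \<in> edges T" "branch K f x = k"
        "branch K f x \<noteq> branch K f y"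
      using p by (auto simp: is_path_def k_def)
    have "x \<le> K" using branch_edge[OF f, of x y K] xy by (simp add: T_def)
    then have "x = k" using xy(3) by (simp add: branch_root)
    with p xy(1) w V show "w \<in> subtree_verts T i k" by (auto simp: subtree_verts_def)
  qed
  moreover have "finite (subtree_verts T i k)" by (simp add: subtree_verts_def V)
  ultimately have "card ({1..n} - branch_verts K n f k) \<le> card (subtree_verts T i k)"
    by (rule card_mono[rotated])
  also have "card (subtree_verts T i k) \<le> psi T i"
    unfolding psi_def using V k i by (intro Max_ge) auto
  finally show ?thesis
    by (subst (asm) card_Diff_subset) (auto simp: branch_verts_def T_def k_def)
qed

text \<open>Cutting the edge between 1 and 2 gives two branches. In the tree rooted at 1 no proper subtree
  meets both of them: a path from 1 that changes branch after it has passed \<open>v \<noteq> 1\<close> would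
  cross the cut edge and so visit 1 a second time.\<close>

lemma psi_root_le:
  assumes f: "parent_map n f" and n: "2 \<le> n"
  shows "\<exists>k\<in>{1..2}. psi (recursive_tree n f) 1 \<le> card (branch_verts 2 n f k)"
proof -
  define T where "T = recursive_tree n f"
  have V: "verts T = {1..n}" by (simp add: T_def recursive_tree_def)
  have "psi T 1 \<in> (\<lambda>v. card (subtree_verts T 1 v)) ` (verts T - {1})"
    unfolding psi_def
  proof (rule Max_in)
    have "2 \<in> verts T - {1}" using V n by simp
    then show "(\<lambda>v. card (subtree_verts T 1 v)) ` (verts T - {1}) \<noteq> {}" by blast
  qed (simp add: V)
  then obtain v where "v \<in> verts T - {1}" "psi T 1 = card (subtree_verts T 1 v)" by blast
  then have v: "v \<in> {1..n}" "v \<noteq> 1" "psi T 1 = card (subtree_verts T 1 v)" by (simp_all add: V)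
  have "subtree_verts T 1 v \<subseteq> branch_verts 2 n f (branch 2 f v)"
  proof
    fix w assume "w \<in> subtree_verts T 1 v"
    then obtain p where w: "w \<in> {1..n}" and p: "is_path T 1 p w" "v \<in> set p"
      by (auto simp: subtree_verts_def V)
    obtain q r where qr: "p = q @ v # r" using p(2) by (auto simp: in_set_conv_decomp)
    have "branch 2 f w = branch 2 f v"
    proof (rule ccontr)
      assume ne: "branch 2 f w \<noteq> branch 2 f v"
      have "\<exists>x\<in>set (v # r). \<exists>y\<in>set (v # r). {x, y} \<in> edges T \<and>
          branch 2 f x = branch 2 f (hd (v # r)) \<and> branch 2 f x \<noteq> branch 2 f y"
      proof (rule successively_crossing)
        show "successively (\<lambda>x y. {x, y} \<in> edges T) (v # r)"
          using p by (simp add: is_path_def qr successively_append_iff)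
        show "branch 2 f (hd (v # r)) \<noteq> branch 2 f (last (v # r))"
          using p ne by (simp add: is_path_def qr)
      qed simp
      then obtain x y where xy: "x \<in> set (v # r)" "y \<in> set (v # r)" "{x, y} \<in> edges T"
          "branch 2 f x \<noteq> branch 2 f y"
        by blast
      have "x \<le> 2" "y \<le> 2" using branch_edge[OF f, of x y 2] xy by (simp_all add: T_def)
      moreover have "x \<noteq> y" using xy by auto
      moreover have "set (v # r) \<subseteq> {1..n}" using p(1) V by (simp add: is_path_def qr)
      then have "1 \<le> x" "1 \<le> y" using xy(1,2) by (meson atLeastAtMost_iff subsetD)+
      ultimately have "x = 1 \<or> y = 1" by linarith
      then have "1 \<in> set (v # r)" using xy(1,2) by metis
      moreover have "hd (q @ v # r) = 1" "distinct (q @ v # r)"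
        using p(1) by (simp_all add: is_path_def qr)
      ultimately show False using v(2) by (cases q) simp_all
    qed
    then show "w \<in> branch_verts 2 n f (branch 2 f v)" using w by (simp add: branch_verts_def)
  qed
  moreover have "finite (branch_verts 2 n f (branch 2 f v))" by (simp add: branch_verts_def)
  ultimately have "psi T 1 \<le> card (branch_verts 2 n f (branch 2 f v))"
    unfolding v(3) by (rule card_mono[rotated])
  moreover have "branch 2 f v \<in> {1..2}" using f v(1) by (intro branch_in) auto
  ultimately show ?thesis unfolding T_def by blast
qed

section \<open>The uniform attachment tree as a random parent map\<close>

text \<open>In the uniform attachment tree the parents of different vertices are independent, and the
  parent of \<open>j\<close> is uniform on the vertices older than \<open>j\<close>.\<close>

definition parents :: "nat \<Rightarrow> (nat \<Rightarrow> nat) pmf" where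
  "parents n = Pi_pmf {2..n} 1 (\<lambda>j. pmf_of_set {1..<j})"

lemma parents_Suc:
  assumes "1 \<le> n"
  shows "parents (Suc n) =
    bind_pmf (parents n) (\<lambda>f. map_pmf (\<lambda>i. f(Suc n := i)) (pmf_of_set {1..n}))"
proof -
  have "{2..Suc n} = insert (Suc n) {2..n}" "{1..<Suc n} = {1..n}" using assms by auto
  then have "parents (Suc n) = bind_pmf (pmf_of_set {1..n})
      (\<lambda>i. bind_pmf (parents n) (\<lambda>f. return_pmf (f(Suc n := i))))"
    by (simp add: parents_def Pi_pmf_insert')
  also have "\<dots> = bind_pmf (parents n) (\<lambda>f. map_pmf (\<lambda>i. f(Suc n := i)) (pmf_of_set {1..n}))"
    by (subst bind_commute_pmf) (simp add: map_pmf_def)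
  finally show ?thesis .
qed

lemma parent_map_parents:
  assumes "f \<in> set_pmf (parents n)"
  shows "parent_map n f"
  unfolding parent_map_def
proof
  fix j assume j: "j \<in> {2..n}"
  then have "f j \<in> set_pmf (pmf_of_set {1..<j})"
    using assms by (simp add: parents_def set_Pi_pmf PiE_dflt_def)
  with j show "f j \<in> {1..<j}" by (subst (asm) set_pmf_of_set) auto
qed

lemma UA_eq_map_parents:
  assumes "2 \<le> n"
  shows "UA n = map_pmf (recursive_tree n) (parents n)"
  using assms
proof (induction n rule: dec_induct)
  case base
  have "{1..<2} = {1::nat}" by auto
  then have "parents 2 = return_pmf (\<lambda>_. 1)"
    by (simp add: parents_def Pi_pmf_singleton pmf_of_set_singleton fun_eq_iff)
  moreover have "{1..2} = {1, 2::nat}" by auto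
  ultimately show ?case by (simp add: recursive_tree_def numeral_2_eq_2)
next
  case (step n)
  then have "UA (Suc n) = bind_pmf (parents n) (\<lambda>f. map_pmf
      (\<lambda>i. attach (recursive_tree n f) i (Suc n)) (pmf_of_set {1..n}))"
    by (simp add: bind_map_pmf attach_def)
  also have "\<dots> = map_pmf (recursive_tree (Suc n)) (parents (Suc n))"
    using step(1) by (simp add: parents_Suc map_bind_pmf pmf.map_comp o_def recursive_tree_Suc)
  finally show ?case .
qed

lemma branch_upd:
  assumes "w < j"
  shows "branch K (f(j := i)) w = branch K f w"
  using assms
proof (induction w rule: less_induct)
  case (less w)
  have "(f(j := i)) w = f w" using less.prems by simp
  then show ?case
    using less branch.simps[of K f w] branch.simps[of K "f(j := i)" w]
    by (auto simp del: fun_upd_apply)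
qed

text \<open>Attaching a vertex below \<open>i\<close> enlarges exactly the branch of \<open>i\<close>: this is the draw from a Polya
  urn whose colours are the branches.\<close>

lemma branch_verts_Suc:
  assumes "K \<le> n" "i \<in> {1..n}"
  shows "branch_verts K (Suc n) (f(Suc n := i)) k =
    branch_verts K n f k \<union> (if branch K f i = k then {Suc n} else {})"
proof -
  have "branch K (f(Suc n := i)) (Suc n) = branch K f i"
    using assms by (subst branch.simps) (simp add: branch_upd)
  then show ?thesis
    using assms by (auto simp: branch_verts_def le_Suc_eq branch_upd)
qed

lemma card_branch_verts_Suc:
  assumes "K \<le> n" "i \<in> {1..n}"
  shows "card (branch_verts K (Suc n) (f(Suc n := i)) k) =
    card (branch_verts K n f k) + of_bool (branch K f i = k)"
proof -
  have "finite (branch_verts K n f k)" "Suc n \<notin> branch_verts K n f k"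
    by (auto simp: branch_verts_def)
  then show ?thesis using branch_verts_Suc[OF assms] by simp
qed

section \<open>The law of a branch size\<close>

lemma measure_bind_pmf:
  "measure_pmf.prob (bind_pmf M N) X = (\<integral>x. measure_pmf.prob (N x) X \<partial>M)"
  unfolding measure_pmf_bind
  by (subst subprob_space.measure_bind[where N = "count_space UNIV"])
     (auto intro: measure_pmf.subprob_space_axioms measure_pmf_in_subprob_algebra)

text \<open>The upper tail of the size of branch \<open>k\<close>; tails give a simpler recursion than point masses.\<close>

definition branch_tail :: "nat \<Rightarrow> nat \<Rightarrow> nat \<Rightarrow> nat \<Rightarrow> real" where
  "branch_tail K n k t = measure_pmf.prob (parents n) {f. t \<le> card (branch_verts K n f k)}"

text \<open>A branch with \<open>c\<close> vertices grows with probability \<open>c / n\<close>. After the step its size is at least \<open>t\<close>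
  iff it already was, or if it was exactly \<open>t - 1\<close> and grew, which has conditional probability
  \<open>(t - 1) / n\<close>.\<close>

lemma branch_tail_Suc:
  assumes K: "1 \<le> K" "K \<le> n" and t: "1 \<le> t"
  shows "branch_tail K (Suc n) k t =
    (1 - real (t - 1) / n) * branch_tail K n k t + real (t - 1) / n * branch_tail K n k (t - 1)"
proof -
  define r where "r = real (t - 1) / n"
  define c where "c f = card (branch_verts K n f k)" for f
  have step: "measure_pmf.prob (map_pmf (\<lambda>i. f(Suc n := i)) (pmf_of_set {1..n}))
      {f. t \<le> card (branch_verts K (Suc n) f k)} =
      (1 - r) * indicator {f. t \<le> c f} f + r * indicator {f. t - 1 \<le> c f} f" for f
  proof -
    have "{1..n} \<noteq> {}" using K by simp
    then have "measure_pmf.prob (map_pmf (\<lambda>i. f(Suc n := i)) (pmf_of_set {1..n}))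
        {f. t \<le> card (branch_verts K (Suc n) f k)} =
        card ({1..n} \<inter> {i. t \<le> card (branch_verts K (Suc n) (f(Suc n := i)) k)}) / n"
      by (simp add: measure_pmf_of_set vimage_def)
    also have "{1..n} \<inter> {i. t \<le> card (branch_verts K (Suc n) (f(Suc n := i)) k)} =
        {i\<in>{1..n}. t \<le> c f + of_bool (branch K f i = k)}"
      using K by (auto simp: card_branch_verts_Suc c_def)
    also have "\<dots> = (if t \<le> c f then {1..n} else if t - 1 \<le> c f then branch_verts K n f k else {})"
      using t by (auto simp: branch_verts_def)
    also have "real (card \<dots>) / n =
        (1 - r) * indicator {f. t \<le> c f} f + r * indicator {f. t - 1 \<le> c f} f"
    proof -
      consider "t \<le> c f" | "c f = t - 1" "\<not> t \<le> c f" | "\<not> t - 1 \<le> c f" by linarith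
      then show ?thesis
        using K by cases (simp_all add: r_def flip: c_def)
    qed
    finally show ?thesis .
  qed
  have "branch_tail K (Suc n) k t =
      (\<integral>f. (1 - r) * indicator {f. t \<le> c f} f + r * indicator {f. t - 1 \<le> c f} f \<partial>parents n)"
  proof -
    have "1 \<le> n" using K by simp
    then show ?thesis unfolding branch_tail_def by (simp only: parents_Suc measure_bind_pmf step)
  qed
  also have "\<dots> = (1 - r) * branch_tail K n k t + r * branch_tail K n k (t - 1)"
    by (subst Bochner_Integration.integral_add)
       (auto simp: branch_tail_def c_def intro!: measure_pmf.integrable_const_bound[where B = "\<bar>1 - r\<bar> + \<bar>r\<bar>"] split: split_indicator)
  finally show ?thesis by (simp add: r_def)
qed

text \<open>By the urn picture the branch sizes are uniformly distributed over all compositions of \<open>n\<close> into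
  \<open>K\<close> positive parts, and the right-hand side is the proportion of those whose \<open>k\<close>-th part is at
  least \<open>t\<close>. The proof checks that this proportion satisfies the recursion of the tails.\<close>

lemma branch_tail_eq:
  assumes K: "2 \<le> K" "K \<le> n" and k: "k \<in> {1..K}" and t: "1 \<le> t"
  shows "branch_tail K n k t = real ((n - t) choose (K - 1)) / real ((n - 1) choose (K - 1))"
  using K(2) t
proof (induction n arbitrary: t rule: dec_induct)
  case base
  have "branch_verts K K f k = {k}" for f using k by (auto simp: branch_verts_def branch_root)
  then have "branch_tail K K k t = of_bool (t \<le> 1)" by (simp add: branch_tail_def)
  also have "\<dots> = real ((K - t) choose (K - 1)) / real ((K - 1) choose (K - 1))"
    using K(1) base by (cases "t = 1") (simp_all add: binomial_eq_0)
  finally show ?case .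
next
  case (step n)
  define a where "a = K - 1"
  have a: "1 \<le> a" "a < n" using K(1) step by (auto simp: a_def)
  have n: "0 < n" using a by simp
  have pos: "0 < real (n choose a)" "0 < real ((n - 1) choose a)"
    using a by (simp_all add: zero_less_binomial)
  have n_eq: "(real n - a) * real (n choose a) = n * real ((n - 1) choose a)"
    using binomial_absorb_comp[of n a] a by (metis of_nat_diff less_imp_le of_nat_mult)
  have rec: "branch_tail K (Suc n) k t =
    (1 - real (t - 1) / n) * branch_tail K n k t + real (t - 1) / n * branch_tail K n k (t - 1)"
    using K(1) step by (intro branch_tail_Suc) auto
  have IH: "branch_tail K n k s = real ((n - s) choose a) / real ((n - 1) choose a)" if "1 \<le> s" for s
    using step.IH[OF that] by (simp add: a_def)
  show ?case
  proof (cases "Suc n < t")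
    case True
    then have "branch_tail K n k t = 0" "branch_tail K n k (t - 1) = 0" "Suc n - t = 0"
      using IH[of t] IH[of "t - 1"] a by (simp_all add: binomial_eq_0)
    then show ?thesis using rec a(1) unfolding a_def[symmetric] by (simp add: binomial_eq_0)
  next
    case False
    \<comment> \<open>In terms of \<open>m\<close> the claim follows from \<open>(m - a) + (n - m) = n - a\<close>.\<close>
    define m where "m = Suc n - t"
    have m: "m \<le> n" "real (t - 1) = real n - m" using False step.prems by (auto simp: m_def of_nat_diff)
    \<comment> \<open>For \<open>t = 1\<close> the induction hypothesis does not reach \<open>t - 1 = 0\<close>, but the coefficient vanishes.\<close>
    have tail: "real (t - 1) / n * branch_tail K n k (t - 1) =
        (real n - m) / n * (real (m choose a) / real ((n - 1) choose a))"
    proof (cases "t = 1")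
      case False
      have "n - (t - 1) = m" using False step.prems by (simp add: m_def)
      then show ?thesis using False step.prems IH[of "t - 1"] m by simp
    qed (use m in simp)
    have "n - t = m - 1" by (simp add: m_def)
    then have "branch_tail K (Suc n) k t =
      (1 - (real n - m) / n) * (real ((m - 1) choose a) / real ((n - 1) choose a)) +
        (real n - m) / n * (real (m choose a) / real ((n - 1) choose a))"
      using rec tail IH[OF step.prems] m by simp
    also have "\<dots> = (m * real ((m - 1) choose a) + (real n - m) * real (m choose a)) /
        (n * real ((n - 1) choose a))"
      using n pos by (simp add: field_simps)
    also have "m * real ((m - 1) choose a) = (real m - a) * real (m choose a)"
    proof (cases "a \<le> m")
      case True
      then show ?thesis using binomial_absorb_comp[of m a] by (metis of_nat_diff of_nat_mult)
    qed (simp add: binomial_eq_0)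
    also have "((real m - a) * real (m choose a) + (real n - m) * real (m choose a)) /
        (n * real ((n - 1) choose a)) = ((real n - a) * real (m choose a)) / ((real n - a) * real (n choose a))"
      unfolding n_eq by (simp add: algebra_simps)
    also have "\<dots> = real (m choose a) / real (n choose a)" using a by simp
    finally show ?thesis by (simp add: a_def m_def)
  qed
qed

section \<open>Tail bounds and the choice of the number of returned vertices\<close>

lemma binomial_ratio_le:
  assumes "m \<le> N"
  shows "(m choose a) * N ^ a \<le> (N choose a) * m ^ a"
proof (induction a)
  case (Suc a)
  have shift: "(m - a) * N \<le> m * (N - a)"
  proof -
    have "a * m \<le> a * N" using assms by simp
    then have "m * N - a * N \<le> m * N - a * m" by (rule diff_le_mono2)
    then show ?thesis by (simp add: diff_mult_distrib diff_mult_distrib2 mult.commute)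
  qed
  have "Suc a * ((m choose Suc a) * N ^ Suc a) = ((m choose a) * N ^ a) * ((m - a) * N)"
    by (metis (no_types, lifting) binomial_absorption binomial_absorb_comp mult.assoc mult.commute power_Suc)
  also have "\<dots> \<le> ((N choose a) * m ^ a) * ((m - a) * N)"
    using Suc by (rule mult_right_mono) simp
  also have "\<dots> \<le> ((N choose a) * m ^ a) * (m * (N - a))"
    using shift by (rule mult_left_mono) simp
  also have "\<dots> = Suc a * ((N choose Suc a) * m ^ Suc a)"
    by (metis (no_types, lifting) binomial_absorption binomial_absorb_comp mult.assoc mult.commute power_Suc)
  finally show ?case by (simp only: Suc_mult_le_cancel1)
qed simp

text \<open>As \<open>n\<close> grows the bound tends to \<open>(1 - x) ^ (K - 1)\<close>, the tail of a coordinate of the uniform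
  distribution on the simplex. A bound valid at every \<open>n\<close> avoids convergence in distribution.\<close>

lemma branch_tail_le:
  fixes x :: real
  assumes K: "2 \<le> K" "K \<le> n" and k: "k \<in> {1..K}" and x: "0 < x" "x < 1"
  shows "measure_pmf.prob (parents n) {f. x * n \<le> card (branch_verts K n f k)}
    \<le> ((1 - x) * (real n / real (n - 1))) ^ (K - 1)"
proof -
  \<comment> \<open>Sizes are integers, so the real threshold may be rounded up.\<close>
  define t where "t = nat \<lceil>x * n\<rceil>"
  have n: "2 \<le> n" using K by simp
  have t: "1 \<le> t" "t \<le> n" "x * n \<le> t"
  proof -
    show "1 \<le> t" using x n unfolding t_def by (simp add: Suc_le_eq)
    have "x * real n \<le> real n" using x by (intro mult_left_le_one_le) auto
    then show "t \<le> n" unfolding t_def by (simp add: ceiling_le_iff nat_le_iff)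
    show "x * n \<le> t" unfolding t_def by (rule of_nat_ceiling)
  qed
  have "{f. x * n \<le> card (branch_verts K n f k)} = {f. t \<le> card (branch_verts K n f k)}"
    by (simp add: t_def nat_le_iff ceiling_le_iff)
  then have "measure_pmf.prob (parents n) {f. x * n \<le> card (branch_verts K n f k)} =
      real ((n - t) choose (K - 1)) / real ((n - 1) choose (K - 1))"
    using branch_tail_eq[OF K k t(1)] by (simp add: branch_tail_def)
  also have "\<dots> \<le> (real (n - t) / real (n - 1)) ^ (K - 1)"
  proof -
    have "real ((n - t) choose (K - 1)) * real (n - 1) ^ (K - 1)
        \<le> real ((n - 1) choose (K - 1)) * real (n - t) ^ (K - 1)"
      using binomial_ratio_le[of "n - t" "n - 1" "K - 1"] t
      by (metis diff_le_mono2 of_nat_le_iff of_nat_mult of_nat_power)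
    moreover have "0 < real ((n - 1) choose (K - 1))" using K by (simp add: zero_less_binomial)
    ultimately show ?thesis using n by (simp add: power_divide divide_simps mult.commute)
  qed
  also have "\<dots> \<le> ((1 - x) * (real n / real (n - 1))) ^ (K - 1)"
  proof (rule power_mono)
    have "real (n - t) \<le> (1 - x) * n" using t by (simp add: of_nat_diff algebra_simps)
    then have "real (n - t) / real (n - 1) \<le> (1 - x) * n / real (n - 1)"
      by (rule divide_right_mono) simp
    then show "real (n - t) / real (n - 1) \<le> (1 - x) * (real n / real (n - 1))"
      using n by (simp add: of_nat_diff)
  qed simp
  finally show ?thesis .
qed

text \<open>The tangent of \<open>exp (x - 1)\<close> at \<open>x = 1\<close>; it locates the maximum of \<open>x * exp (- x)\<close>.\<close>

lemma le_exp_minus_one: "(x :: real) \<le> exp (x - 1)"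
  using exp_ge_add_one_self[of "x - 1"] by simp

text \<open>Here the constant 2.5 enters. With \<open>L = ln (1 / \<epsilon>)\<close>, the function \<open>y * exp (- y)\<close> of \<open>y = \<epsilon> * K\<close> is
  decreasing for \<open>y \<ge> 1\<close>, so the worst case is \<open>y = 2.5 * L\<close>. There \<open>exp (- y)\<close> is the power 2.5 of
  \<open>\<epsilon>\<close>, and the claim reduces to \<open>2.5 * L \<le> 2 * exp (L / 2)\<close>, which holds since
  \<open>L \<le> 2 * exp (L / 2) / exp 1\<close> and \<open>exp 1 \<ge> 2.5\<close>. The bound on \<open>\<epsilon>\<close> ensures \<open>y \<ge> 1\<close>.\<close>

lemma exceptional_branch_bound:
  fixes \<epsilon> :: real and K :: nat
  assumes \<epsilon>: "0 < \<epsilon>" "\<epsilon> < 1 / 5" and K: "2.5 * (ln (1 / \<epsilon>) / \<epsilon>) \<le> real K"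
  shows "K * (1 - \<epsilon>) ^ (K - 1) \<le> 2 * \<epsilon> / (1 - \<epsilon>)"
proof -
  define L where "L = ln (1 / \<epsilon>)"
  have "1 < L"
  proof -
    have "exp 1 < (5::real)" using exp_le by linarith
    also have "5 < 1 / \<epsilon>" using \<epsilon> by (simp add: field_simps)
    finally have "ln (exp 1) < ln (1 / \<epsilon>)" using \<epsilon> by (intro ln_less_cancel_iff[THEN iffD2]) simp_all
    then show ?thesis by (simp only: L_def ln_exp)
  qed
  \<comment> \<open>The excess of \<open>\<epsilon> * K\<close> over the worst case.\<close>
  define s where "s = \<epsilon> * K - 2.5 * L"
  have s: "0 \<le> s" using K \<epsilon> by (simp add: s_def L_def field_simps)
  have eK: "\<epsilon> * K = 2.5 * L + s" by (simp add: s_def)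
  have K0: "0 < K" using eK s \<open>1 < L\<close> by (cases "K = 0") auto
  have "(1 - \<epsilon>) * (1 - \<epsilon>) ^ (K - 1) = (1 - \<epsilon>) ^ K" using K0 by (simp add: power_eq_if)
  also have "\<dots> \<le> exp (- \<epsilon>) ^ K"
    using \<epsilon> exp_ge_add_one_self[of "- \<epsilon>"] by (intro power_mono) auto
  also have "\<dots> = exp (- (\<epsilon> * K))" by (simp add: exp_of_nat_mult[symmetric] mult.commute)
  finally have pow: "(1 - \<epsilon>) * (1 - \<epsilon>) ^ (K - 1) \<le> exp (- (\<epsilon> * K))" .
  \<comment> \<open>Monotonicity of \<open>y * exp (- y)\<close>: the excess \<open>s\<close> gains at most the factor \<open>exp s\<close>, which cancels below.\<close>
  have le: "\<epsilon> * K \<le> 2.5 * L * exp s"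
  proof -
    have "2.5 * L + s \<le> 2.5 * L * (1 + s)"
      using mult_right_mono[of 1 "2.5 * L" s] \<open>1 < L\<close> s by (simp add: algebra_simps)
    also have "\<dots> \<le> 2.5 * L * exp s"
      using \<open>1 < L\<close> exp_ge_add_one_self[of s] by (intro mult_left_mono) auto
    finally show ?thesis by (simp add: eK)
  qed
  have "5 / 2 \<le> exp (1::real)"
    using exp_lower_Taylor_quadratic[of "1::real"] by simp
  have "2.5 * L \<le> 2 * exp (L / 2)"
  proof -
    have "L / 2 \<le> exp (L / 2 - 1)" by (rule le_exp_minus_one)
    also have "\<dots> = exp (L / 2) / exp 1" by (simp add: exp_diff)
    also have "\<dots> \<le> exp (L / 2) / (5 / 2)"
      using \<open>5 / 2 \<le> exp 1\<close> by (intro divide_left_mono) auto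
    finally show ?thesis by simp
  qed
  have "\<epsilon> * (K * ((1 - \<epsilon>) * (1 - \<epsilon>) ^ (K - 1))) \<le> (\<epsilon> * K) * exp (- (\<epsilon> * K))"
    using pow \<epsilon> by (simp add: mult_left_mono)
  also have "\<dots> \<le> (2.5 * L * exp s) * exp (- (\<epsilon> * K))"
    using le by (rule mult_right_mono) simp
  also have "\<dots> = 2.5 * L * exp (- (2.5 * L))"
    by (simp add: eK exp_add[symmetric] exp_minus field_simps)
  also have "\<dots> \<le> 2 * exp (L / 2) * exp (- (2.5 * L))"
    using \<open>2.5 * L \<le> 2 * exp (L / 2)\<close> by (rule mult_right_mono) simp
  also have "\<dots> = 2 * exp (- L) ^ 2"
    by (simp add: exp_add[symmetric] power2_eq_square)
  also have "exp (- L) = \<epsilon>" using \<epsilon> by (simp add: L_def exp_minus ln_div)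
  finally have "\<epsilon> * (K * ((1 - \<epsilon>) * (1 - \<epsilon>) ^ (K - 1))) \<le> \<epsilon> * (2 * \<epsilon>)"
    by (simp add: power2_eq_square)
  then have "K * ((1 - \<epsilon>) * (1 - \<epsilon>) ^ (K - 1)) \<le> 2 * \<epsilon>"
    using \<epsilon> by simp
  then show ?thesis using \<epsilon> by (simp add: pos_le_divide_eq mult_ac)
qed

text \<open>Outside the events \<open>B\<close> (one of the two branches at the first edge is large) and \<open>C\<close> (one of the
  \<open>K\<close> branches is large), the root scores strictly below \<open>(1 - x) * n\<close> and every vertex after \<open>K\<close>
  strictly above it, so the root is returned. Both events are controlled by a union bound.\<close>

lemma prob_root_omitted_le:
  fixes x :: real
  assumes x: "0 < x" "x < 1" and K: "2 \<le> K" "K \<le> n"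
    and naming: "vertex_naming rep name" and H: "is_H_psi K rep H"
  shows "measure_pmf.prob (UA n) {T. name T 1 \<notin> H (unlabeled T)}
    \<le> 2 * (x * (real n / real (n - 1))) + K * ((1 - x) * (real n / real (n - 1))) ^ (K - 1)"
proof -
  let ?P = "measure_pmf.prob (parents n)"
  define B where "B = {f. \<exists>k\<in>{1..2}. (1 - x) * n \<le> card (branch_verts 2 n f k)}"
  define C where "C = {f. \<exists>k\<in>{1..K}. x * n \<le> card (branch_verts K n f k)}"
  have "?P B \<le> (\<Sum>k\<in>{1..2}. ?P {f. (1 - x) * n \<le> card (branch_verts 2 n f k)})"
  proof -
    have "B = (\<Union>k\<in>{1..2}. {f. (1 - x) * n \<le> card (branch_verts 2 n f k)})" by (auto simp: B_def)
    then show ?thesis by (simp only:) (rule measure_pmf.finite_measure_subadditive_finite, auto)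
  qed
  also have "\<dots> \<le> (\<Sum>k\<in>{1..2::nat}. x * (real n / real (n - 1)))"
  proof (rule sum_mono)
    fix k :: nat assume "k \<in> {1..2}"
    then show "?P {f. (1 - x) * n \<le> card (branch_verts 2 n f k)} \<le> x * (real n / real (n - 1))"
      using branch_tail_le[of 2 n k "1 - x"] x K by simp
  qed
  finally have B: "?P B \<le> 2 * (x * (real n / real (n - 1)))" by simp
  have "?P C \<le> (\<Sum>k\<in>{1..K}. ?P {f. x * n \<le> card (branch_verts K n f k)})"
  proof -
    have "C = (\<Union>k\<in>{1..K}. {f. x * n \<le> card (branch_verts K n f k)})" by (auto simp: C_def)
    then show ?thesis by (simp only:) (rule measure_pmf.finite_measure_subadditive_finite, auto)
  qed
  also have "\<dots> \<le> (\<Sum>k\<in>{1..K}. ((1 - x) * (real n / real (n - 1))) ^ (K - 1))"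
    using branch_tail_le[OF K _ x] by (intro sum_mono) auto
  finally have C: "?P C \<le> K * ((1 - x) * (real n / real (n - 1))) ^ (K - 1)" by simp
  have sub: "f \<in> B \<union> C"
    if f: "f \<in> set_pmf (parents n)" and omit: "name T 1 \<notin> H (unlabeled T)"
      and T_def: "T = recursive_tree n f" for f T
  proof (rule ccontr)
    assume notin: "f \<notin> B \<union> C"
    have pm: "parent_map n f" using f by (rule parent_map_parents)
    have "is_tree T" unfolding T_def using pm K by (intro is_tree_recursive_tree) auto
    moreover have "verts T = {1..n}" by (simp add: T_def recursive_tree_def)
    ultimately obtain i where i: "i \<in> {K<..n}" "psi T i \<le> psi T 1"
      using smallest_psi_omits[OF naming H _ _ _ K(2) omit] K by auto
    obtain k where k: "k \<in> {1..2}" "psi T 1 \<le> card (branch_verts 2 n f k)"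
      using psi_root_le[OF pm] K unfolding T_def by auto
    have "\<not> (1 - x) * n \<le> card (branch_verts 2 n f k)"
      using notin k(1) unfolding B_def by blast
    then have up: "real (psi T i) < (1 - x) * n" using i(2) k(2) by linarith
    have "branch K f i \<in> {1..K}" using pm K i by (intro branch_in) auto
    then have "\<not> x * n \<le> card (branch_verts K n f (branch K f i))"
      using notin unfolding C_def by blast
    moreover have "n - card (branch_verts K n f (branch K f i)) \<le> psi T i"
      unfolding T_def using pm K i by (intro card_branch_complement_le_psi) auto
    then have "real n \<le> psi T i + card (branch_verts K n f (branch K f i))" by linarith
    ultimately show False using up by (simp add: left_diff_distrib)
  qed
  have "measure_pmf.prob (UA n) {T. name T 1 \<notin> H (unlabeled T)} =
      ?P (recursive_tree n -` {T. name T 1 \<notin> H (unlabeled T)})"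
    using K by (simp add: UA_eq_map_parents)
  also have "\<dots> \<le> ?P (B \<union> C)"
    using sub by (intro measure_pmf.finite_measure_mono_AE) (auto simp: AE_measure_pmf_iff)
  also have "\<dots> \<le> ?P B + ?P C" by (rule measure_Un_le) auto
  finally show ?thesis using add_mono[OF B C] by (rule order_trans)
qed

theorem theorem3:
  fixes \<epsilon> :: real and K :: nat
    and rep :: "nat graph set \<Rightarrow> nat graph"
    and name :: "nat graph \<Rightarrow> nat \<Rightarrow> nat"
    and H :: "nat graph set \<Rightarrow> nat set"
  assumes "0 < \<epsilon>" and "\<epsilon> < 1"
    and "0 < K"
    and "real K \<ge> 2.5 * (ln (1 / \<epsilon>) / \<epsilon>)"
    and "vertex_naming rep name"
    and "is_H_psi K rep H"
  shows "liminf (\<lambda>n. ereal (measure_pmf.prob (UA n) {T. name T 1 \<in> H (unlabeled T)}))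
           \<ge> ereal (1 - 4 * \<epsilon> / (1 - \<epsilon>))"
proof (cases "\<epsilon> < 1 / 5")
  case False
  \<comment> \<open>For large \<open>\<epsilon>\<close> the claimed bound is not positive.\<close>
  then have "1 - 4 * \<epsilon> / (1 - \<epsilon>) \<le> 0" using assms(2) by (simp add: field_simps)
  then have "ereal (1 - 4 * \<epsilon> / (1 - \<epsilon>)) \<le> ereal (measure_pmf.prob (UA n) {T. name T 1 \<in> H (unlabeled T)})"
    for n by (simp add: order_trans[OF _ measure_nonneg])
  then show ?thesis by (intro Liminf_bounded always_eventually) simp
next
  case True
  have bound: "K * (1 - \<epsilon>) ^ (K - 1) \<le> 2 * \<epsilon> / (1 - \<epsilon>)"
    using assms(1,4) True by (intro exceptional_branch_bound) auto
  have K: "2 \<le> K"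
  proof (rule ccontr)
    assume "\<not> 2 \<le> K"
    with assms(3) have "K = 1" by simp
    then have "1 \<le> 2 * \<epsilon> / (1 - \<epsilon>)" using bound by simp
    then show False using True by (simp add: field_simps)
  qed
  \<comment> \<open>The value \<open>x = \<epsilon>\<close> in the finite bound gives errors with limit \<open>2 * \<epsilon> + K * (1 - \<epsilon>) ^ (K - 1)\<close>.\<close>
  define g where "g n = 1 - (2 * (\<epsilon> * (real n / real (n - 1))) + K * ((1 - \<epsilon>) * (real n / real (n - 1))) ^ (K - 1))" for n :: nat
  have "(\<lambda>n. real n / real (n - 1)) \<longlonglongrightarrow> 1"
    by (rule LIMSEQ_imp_Suc) (use LIMSEQ_Suc_n_over_n[where 'a = real] in simp)
  then have "g \<longlonglongrightarrow> 1 - (2 * (\<epsilon> * 1) + K * ((1 - \<epsilon>) * 1) ^ (K - 1))"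
    unfolding g_def by (intro tendsto_intros)
  then have lim: "(\<lambda>n. ereal (g n)) \<longlonglongrightarrow> ereal (1 - (2 * \<epsilon> + K * (1 - \<epsilon>) ^ (K - 1)))"
    by simp
  have "1 - 4 * \<epsilon> / (1 - \<epsilon>) \<le> 1 - (2 * \<epsilon> + K * (1 - \<epsilon>) ^ (K - 1))"
  proof -
    have "2 * \<epsilon> \<le> 2 * \<epsilon> / (1 - \<epsilon>)" using assms(1,2) by (simp add: field_simps)
    then show ?thesis using bound by (simp add: add_divide_distrib)
  qed
  then have "ereal (1 - 4 * \<epsilon> / (1 - \<epsilon>)) \<le> ereal (1 - (2 * \<epsilon> + K * (1 - \<epsilon>) ^ (K - 1)))"
    by (simp only: ereal_less_eq)
  also have "\<dots> = liminf (\<lambda>n. ereal (g n))"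
    using lim by (rule lim_imp_Liminf[symmetric, rotated]) simp
  also have "\<dots> \<le>
      liminf (\<lambda>n. ereal (measure_pmf.prob (UA n) {T. name T 1 \<in> H (unlabeled T)}))"
  proof (rule Liminf_mono)
    have "g n \<le> measure_pmf.prob (UA n) {T. name T 1 \<in> H (unlabeled T)}" if "K \<le> n" for n
    proof -
      have "{T. name T 1 \<notin> H (unlabeled T)} = UNIV - {T. name T 1 \<in> H (unlabeled T)}" by auto
      then have "measure_pmf.prob (UA n) {T. name T 1 \<notin> H (unlabeled T)} =
          1 - measure_pmf.prob (UA n) {T. name T 1 \<in> H (unlabeled T)}"
        using measure_pmf.prob_compl[of "{T. name T 1 \<in> H (unlabeled T)}" "UA n"] by simp
      then show ?thesis
        using prob_root_omitted_le[OF assms(1,2) K that assms(5,6)] by (simp add: g_def)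
    qed
    then show "\<forall>\<^sub>F n in sequentially. ereal (g n) \<le>
        ereal (measure_pmf.prob (UA n) {T. name T 1 \<in> H (unlabeled T)})"
      by (intro eventually_sequentiallyI[of K]) simp
  qed
  finally show ?thesis .
qed

end
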